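(* Let $\varphi:\mathbb{R}^{m}\to\mathbb{R}^{n}$ be the polynomial map $\varphi(X)=(X^{t}A_{1}X,\ldots,X^{t}A_{n}X)+(AX)^{t}+b$ between Euclidean spaces with their standard metrics, where $X\in\mathbb{R}^m$ is a column vector, $A_i$ is a real symmetric $m\times m$ matrix for $i=1,\ldots,n$, $A$ is a real $n\times m$ matrix, and $b\in\mathbb{R}^{n}$. Then $\varphi$ is an $\infty$-harmonic map if and only if $\varphi$ is an affine map with $\varphi(X)=(AX)^{t}+b$ for all $X\in\mathbb{R}^m$.
   Context: A smooth map $\varphi:(M,g)\to(N,h)$ between Riemannian manifolds is called $\infty$-harmonic if $\tfrac12\,{\rm d}\varphi({\rm grad}\,|{\rm d}\varphi|^2)=0$ on $M$, where $|{\rm d}\varphi|^2={\rm Trace}_g\,\varphi^*h$ is the energy density of $\varphi$ and the gradient is taken with respect to $g$. Elements of $\mathbb{R}^n$ are written as row vectors here. *)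

theory Defs
  imports "HOL-Analysis.Analysis"
begin

text \<open>\<open>C\<^sup>k\<close> maps on the whole space. By finite dimensionality it is enough to iterate
  \<open>x \<mapsto> d f\<^sub>x(v)\<close> for fixed directions \<open>v\<close>.\<close>

primrec Ck_map :: "nat \<Rightarrow> ('a::euclidean_space \<Rightarrow> 'b::euclidean_space) \<Rightarrow> bool" where
  "Ck_map 0 f \<longleftrightarrow> continuous_on UNIV f"
| "Ck_map (Suc k) f \<longleftrightarrow>
     (\<forall>x. f differentiable (at x)) \<and> (\<forall>v. Ck_map k (\<lambda>x. frechet_derivative f (at x) v))"

definition smooth_map :: "('a::euclidean_space \<Rightarrow> 'b::euclidean_space) \<Rightarrow> bool" where
  "smooth_map f \<longleftrightarrow> (\<forall>k. Ck_map k f)"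

text \<open>Maps between Euclidean spaces, domain \<open>g\<close> and codomain \<open>h\<close> both being the standard
  metric, i.e. the inner product on every tangent space. \<open>Basis\<close> is an orthonormal basis, so
  \<open>metric_trace\<close> is \<open>Trace\<^sub>g\<close>.\<close>

definition pullback_metric ::
  "('a::euclidean_space \<Rightarrow> 'b::euclidean_space) \<Rightarrow> 'a \<Rightarrow> 'a \<Rightarrow> 'a \<Rightarrow> real" where
  "pullback_metric f x v w =
     frechet_derivative f (at x) v \<bullet> frechet_derivative f (at x) w"

definition metric_trace :: "('a::euclidean_space \<Rightarrow> 'a \<Rightarrow> real) \<Rightarrow> real" where
  "metric_trace B = (\<Sum>e\<in>Basis. B e e)"

definition energy_density :: "('a::euclidean_space \<Rightarrow> 'b::euclidean_space) \<Rightarrow> 'a \<Rightarrow> real" where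
  "energy_density f x = metric_trace (pullback_metric f x)"

text \<open>The gradient is well defined wherever \<open>u\<close> is differentiable; in \<open>infinity_harmonic\<close>
  it is only used for the energy density of a smooth map.\<close>

definition gradient :: "('a::euclidean_space \<Rightarrow> real) \<Rightarrow> 'a \<Rightarrow> 'a" where
  "gradient u x = (THE v. GDERIV u x :> v)"

definition infinity_harmonic :: "('a::euclidean_space \<Rightarrow> 'b::euclidean_space) \<Rightarrow> bool" where
  "infinity_harmonic f \<longleftrightarrow> smooth_map f \<and>
     (\<forall>x. (1/2) *\<^sub>R frechet_derivative f (at x) (gradient (energy_density f) x) = 0)"

end

theory Submission imports Defs begin

text \<open>With \<open>G\<^sub>i(X) = 2 Q\<^sub>i X + a\<^sub>i\<close>, where \<open>a\<^sub>i\<close> is the \<open>i\<close>-th row of \<open>A\<close>, the differential of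
  \<open>\<phi>\<close> is \<open>V \<mapsto> (G\<^sub>i(X) \<bullet> V)\<^sub>i\<close>, the energy density is \<open>\<Sum>\<^sub>i |G\<^sub>i|\<^sup>2\<close> and its gradient is
  \<open>4 \<Sum>\<^sub>i Q\<^sub>i G\<^sub>i\<close>. The quadratic part of the \<open>\<infinity>\<close>-harmonic equation says that
  \<open>Q\<^sub>j X \<bullet> S X = 0\<close> for all \<open>j\<close> and \<open>X\<close>, where \<open>S = \<Sum>\<^sub>i Q\<^sub>i\<^sup>2\<close>. Polarising, putting \<open>Q\<^sub>j X\<close>
  into the second slot and summing over \<open>j\<close> gives
  \<open>|S X|\<^sup>2 + \<Sum>\<^sub>j Q\<^sub>j X \<bullet> S Q\<^sub>j X = 0\<close>. As \<open>S\<close> is positive semidefinite, \<open>S = 0\<close>, and hence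
  every \<open>Q\<^sub>j\<close> vanishes.\<close>

text \<open>Derivatives are unique, and the functional \<open>\<lambda>h. h \<bullet> v\<close>
  determines \<open>v\<close>, so the definite description in \<open>gradient\<close> has only one
  candidate.\<close>

lemma gradient_eqI:
  assumes "GDERIV u x :> v"
  shows "gradient u x = v"
  unfolding gradient_def
proof (rule the_equality)
  show "GDERIV u x :> v"
    by (rule assms)
next
  fix w assume "GDERIV u x :> w"
  then have "(\<lambda>h. h \<bullet> w) = (\<lambda>h. h \<bullet> v)"
    using assms unfolding gderiv_def by (rule has_derivative_unique)
  then show "w = v"
    by (simp add: fun_eq_iff vector_eq_ldot)
qed

lemma Ck_map_const: "Ck_map k (\<lambda>x. c)"
  by (induction k arbitrary: c) auto

text \<open>The differential is \<open>g\<close> at every point, so each directional derivative is a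
  constant map and \<open>Ck_map_const\<close> settles all higher orders.\<close>

lemma smooth_map_affine:
  fixes f :: "'a::euclidean_space \<Rightarrow> 'b::euclidean_space"
  assumes "\<And>x. f x = g x + c" and "bounded_linear g"
  shows "smooth_map f"
proof -
  have f: "f = (\<lambda>x. g x + c)"
    using assms(1) by blast
  have d: "(f has_derivative g) (at x)" for x
    unfolding f using bounded_linear_imp_has_derivative[OF assms(2)]
    by (auto intro!: derivative_eq_intros)
  have "Ck_map k f" for k
  proof (cases k)
    case 0
    then show ?thesis
      using has_derivative_continuous[OF d] by (simp add: continuous_at_imp_continuous_on)
  next
    case (Suc l)
    then show ?thesis
      using d Ck_map_const[of l] frechet_derivative_at[OF d] by (auto intro: differentiableI)
  qed
  then show ?thesis
    by (simp add: smooth_map_def)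
qed

lemma self_adjoint_sum_squares_eq_0:
  fixes T :: "'i::finite \<Rightarrow> 'a::real_inner \<Rightarrow> 'a"
  assumes lin: "\<And>i. linear (T i)"
    and adj: "\<And>i x y. T i x \<bullet> y = x \<bullet> T i y"
    and orth: "\<And>j x. T j x \<bullet> (\<Sum>i\<in>UNIV. T i (T i x)) = 0"
  shows "T j x = 0"
proof -
  define S where "S x = (\<Sum>i\<in>UNIV. T i (T i x))" for x
  have S_add: "S (x + y) = S x + S y" for x y
    by (simp add: S_def linear_add[OF lin] sum.distrib)
  have S_sq: "S x \<bullet> x = (\<Sum>i\<in>UNIV. T i x \<bullet> T i x)" for x
    by (simp add: S_def inner_sum_left adj)
  have pol: "T j x \<bullet> S y + T j y \<bullet> S x = 0" for j x y
    using orth[of j "x + y", folded S_def] orth[of j x, folded S_def] orth[of j y, folded S_def]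
    by (simp add: S_add linear_add[OF lin] inner_add_left inner_add_right)
  have "0 = (\<Sum>j\<in>UNIV. T j x \<bullet> S (T j x) + T j (T j x) \<bullet> S x)"
    by (simp add: pol)
  \<comment> \<open>Summed over \<open>j\<close>, the vectors \<open>T j (T j x)\<close> reassemble
    to \<open>S x\<close>.\<close>
  also have "\<dots> = (\<Sum>j\<in>UNIV. S (T j x) \<bullet> T j x) + S x \<bullet> S x"
    by (simp add: sum.distrib S_def inner_sum_left[symmetric] inner_commute)
  finally have sum0: "(\<Sum>j\<in>UNIV. S (T j x) \<bullet> T j x) + S x \<bullet> S x = 0"
    by (rule sym)
  have "0 \<le> (\<Sum>j\<in>UNIV. S (T j x) \<bullet> T j x)"
    unfolding S_sq by (intro sum_nonneg inner_ge_zero)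
  with sum0 have "S x \<bullet> S x \<le> 0"
    by linarith
  then have "S x = 0"
    by (metis inner_eq_zero_iff inner_ge_zero order_antisym)
  \<comment> \<open>By \<open>S_sq\<close>, \<open>S x \<bullet> x\<close> is a sum of squared
    norms, so its vanishing forces each \<open>T i x\<close> to vanish.\<close>
  then have "(\<Sum>i\<in>UNIV. T i x \<bullet> T i x) = 0"
    using S_sq[of x] by simp
  then show ?thesis
    by (simp add: sum_nonneg_eq_0_iff)
qed

lemma symmetric_matrix_adjoint:
  fixes M :: "real^'m^'m"
  assumes "transpose M = M"
  shows "(M *v x) \<bullet> y = x \<bullet> (M *v y)"
  using dot_lmul_matrix[of x M y] vector_transpose_matrix[of x M] assms by simp

lemma has_derivative_vec_lambda:
  fixes f :: "'i::finite \<Rightarrow> 'a::real_normed_vector \<Rightarrow> real"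
  assumes "\<And>i. (f i has_derivative f' i) F"
  shows "((\<lambda>x. \<chi> i. f i x) has_derivative (\<lambda>v. \<chi> i. f' i v)) F"
proof -
  have eq: "(\<chi> i. g i) = (\<Sum>i\<in>UNIV. g i *\<^sub>R axis i 1)" for g :: "'i \<Rightarrow> real"
    by (simp add: vec_eq_iff axis_def if_distrib cong: if_cong)
  show ?thesis
    unfolding eq by (intro has_derivative_sum has_derivative_scaleR_left assms)
qed

text \<open>Symmetry of \<open>Q i\<close> makes the two terms of the product rule equal, whence the
  factor 2; the linear part contributes the row \<open>A $ i\<close>.\<close>

lemma has_derivative_quadratic_map:
  fixes Q :: "'n::finite \<Rightarrow> real^'m^'m" and A :: "real^'m^'n"
  assumes sym: "\<And>i. transpose (Q i) = Q i"
  shows "((\<lambda>X. (\<chi> i. X \<bullet> (Q i *v X)) + A *v X + b) has_derivative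
          (\<lambda>V. \<chi> i. (2 *\<^sub>R (Q i *v X) + A $ i) \<bullet> V)) (at X)"
proof -
  have "((\<lambda>X. (\<chi> i. X \<bullet> (Q i *v X)) + A *v X + b) has_derivative
          (\<lambda>V. (\<chi> i. X \<bullet> (Q i *v V) + V \<bullet> (Q i *v X)) + A *v V)) (at X)"
    by (intro has_derivative_add_const has_derivative_add has_derivative_vec_lambda
        has_derivative_inner has_derivative_ident
        bounded_linear_imp_has_derivative matrix_vector_mul_bounded_linear)
  moreover have "(\<chi> i. X \<bullet> (Q i *v V) + V \<bullet> (Q i *v X)) + A *v V
      = (\<chi> i. (2 *\<^sub>R (Q i *v X) + A $ i) \<bullet> V)" for V
    by (simp add: vec_eq_iff matrix_vector_mul_component inner_add_left
        symmetric_matrix_adjoint[OF sym] inner_commute[of V])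
  ultimately show ?thesis
    by simp
qed

text \<open>After the two sums are exchanged, Parseval's identity over \<open>Basis\<close> applies
  to each \<open>g i\<close> separately.\<close>

lemma energy_density_eq_sum_norm:
  fixes f :: "'a::euclidean_space \<Rightarrow> real^'n"
  assumes "(f has_derivative (\<lambda>v. \<chi> i. g i \<bullet> v)) (at x)"
  shows "energy_density f x = (\<Sum>i\<in>UNIV. g i \<bullet> g i)"
proof -
  have "energy_density f x = (\<Sum>e\<in>Basis. \<Sum>i\<in>UNIV. (g i \<bullet> e) * (g i \<bullet> e))"
    unfolding energy_density_def metric_trace_def pullback_metric_def
      frechet_derivative_at[OF assms, symmetric]
    by (simp add: inner_vec_def)
  also have "\<dots> = (\<Sum>i\<in>UNIV. g i \<bullet> g i)"
    by (subst sum.swap) (simp add: euclidean_inner[symmetric])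
  finally show ?thesis .
qed

text \<open>One factor 2 comes from the product rule and another from the derivative of
  \<open>G i\<close>; self-adjointness then moves \<open>Q i\<close> from the direction
  \<open>V\<close> onto \<open>G i X\<close>.\<close>

lemma gradient_sum_norm:
  fixes Q :: "'n::finite \<Rightarrow> real^'m^'m" and a :: "'n \<Rightarrow> real^'m"
  assumes sym: "\<And>i. transpose (Q i) = Q i"
  defines "G \<equiv> \<lambda>i X. 2 *\<^sub>R (Q i *v X) + a i"
  shows "gradient (\<lambda>X. \<Sum>i\<in>UNIV. G i X \<bullet> G i X) X = 4 *\<^sub>R (\<Sum>i\<in>UNIV. Q i *v G i X)"
proof (rule gradient_eqI)
  have "((\<lambda>X. \<Sum>i\<in>UNIV. G i X \<bullet> G i X) has_derivative
      (\<lambda>V. \<Sum>i\<in>UNIV. G i X \<bullet> (2 *\<^sub>R (Q i *v V)) + (2 *\<^sub>R (Q i *v V)) \<bullet> G i X)) (at X)"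
    unfolding G_def
    by (auto intro!: derivative_eq_intros
        bounded_linear.has_derivative[OF matrix_vector_mul_bounded_linear])
  moreover have "(\<Sum>i\<in>UNIV. G i X \<bullet> (2 *\<^sub>R (Q i *v V)) + (2 *\<^sub>R (Q i *v V)) \<bullet> G i X)
      = V \<bullet> (4 *\<^sub>R (\<Sum>i\<in>UNIV. Q i *v G i X))" for V
    by (simp add: inner_sum_right sum_distrib_left symmetric_matrix_adjoint[OF sym]
        inner_commute[of "G _ X"])
  ultimately show "GDERIV (\<lambda>X. \<Sum>i\<in>UNIV. G i X \<bullet> G i X) X :> 4 *\<^sub>R (\<Sum>i\<in>UNIV. Q i *v G i X)"
    by (simp add: gderiv_def)
qed

theorem theorem2p3:
  fixes \<phi> :: "real^'m \<Rightarrow> real^'n"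
    and Q :: "'n \<Rightarrow> real^'m^'m"
    and A :: "real^'m^'n"
    and b :: "real^'n"
  assumes sym: "\<And>i. transpose (Q i) = Q i"
    and phi: "\<And>X. \<phi> X = (\<chi> i. X \<bullet> (Q i *v X)) + A *v X + b"
  shows "infinity_harmonic \<phi> \<longleftrightarrow> (\<forall>X. \<phi> X = A *v X + b)"
proof
  define G where "G = (\<lambda>i X. 2 *\<^sub>R (Q i *v X) + A $ i)"
  have phi': "\<phi> = (\<lambda>X. (\<chi> i. X \<bullet> (Q i *v X)) + A *v X + b)"
    using phi by blast
  have d: "(\<phi> has_derivative (\<lambda>V. \<chi> i. G i X \<bullet> V)) (at X)" for X
    unfolding phi' G_def by (rule has_derivative_quadratic_map[OF sym])
  have energy: "energy_density \<phi> = (\<lambda>X. \<Sum>i\<in>UNIV. G i X \<bullet> G i X)"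
    using energy_density_eq_sum_norm[OF d] by blast
  have grad: "gradient (energy_density \<phi>) X = 4 *\<^sub>R (\<Sum>i\<in>UNIV. Q i *v G i X)" for X
    unfolding energy G_def by (rule gradient_sum_norm[OF sym])
  assume "infinity_harmonic \<phi>"
  then have "(\<chi> i. G i X \<bullet> gradient (energy_density \<phi>) X) = 0" for X
    unfolding infinity_harmonic_def frechet_derivative_at[OF d, symmetric] by simp
  then have eq: "G j X \<bullet> (\<Sum>i\<in>UNIV. Q i *v G i X) = 0" for j X
    unfolding grad by (simp add: vec_eq_iff)
  have "(Q j *v X) \<bullet> (\<Sum>i\<in>UNIV. Q i *v (Q i *v X)) = 0" for j X
  proof -
    define s where "s = (\<Sum>i\<in>UNIV. Q i *v (Q i *v X))"
    define c where "c = (\<Sum>i\<in>UNIV. Q i *v (A $ i))"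
    \<comment> \<open>Restricting to the line through \<open>X\<close> turns the equation into a
      quadratic polynomial in \<open>t\<close> that vanishes identically.\<close>
    have "(\<Sum>i\<in>UNIV. Q i *v G i (t *\<^sub>R X)) = (2 * t) *\<^sub>R s + c" for t
      by (simp add: G_def s_def c_def matrix_vector_right_distrib matrix_vector_mult_scaleR
          sum.distrib scaleR_sum_right)
    then have "((2 * t) *\<^sub>R (Q j *v X) + A $ j) \<bullet> ((2 * t) *\<^sub>R s + c) = 0" for t
      using eq[of j "t *\<^sub>R X"] by (simp add: G_def matrix_vector_mult_scaleR)
    \<comment> \<open>The values at 1 and -1 minus twice the value at 0 leave 8 times
      \<open>(Q j *v X) \<bullet> s\<close>.\<close>
    from this[of 1] this[of "-1"] this[of 0] show ?thesis
      unfolding s_def[symmetric]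
      by (simp add: inner_add_left inner_add_right inner_diff_left inner_diff_right)
  qed
  then have Q0: "Q j *v X = 0" for j X
    by (intro self_adjoint_sum_squares_eq_0[of "\<lambda>j X. Q j *v X"])
      (auto simp: symmetric_matrix_adjoint[OF sym])
  then show "\<forall>X. \<phi> X = A *v X + b"
    unfolding phi Q0 by (simp add: vec_eq_iff)
next
  assume affine: "\<forall>X. \<phi> X = A *v X + b"
  have phi': "\<phi> = (\<lambda>X. A *v X + b)"
    using affine by blast
  have d: "(\<phi> has_derivative (*v) A) (at X)" for X
    unfolding phi'
    by (auto intro!: derivative_eq_intros
        bounded_linear.has_derivative[OF matrix_vector_mul_bounded_linear])
  have "energy_density \<phi> = (\<lambda>X. metric_trace (\<lambda>v w. (A *v v) \<bullet> (A *v w)))"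
    unfolding energy_density_def pullback_metric_def frechet_derivative_at[OF d, symmetric] ..
  \<comment> \<open>The energy density is constant because the differential is \<open>A\<close> at
    every point.\<close>
  then have "gradient (energy_density \<phi>) X = 0" for X
    by (auto intro!: gradient_eqI GDERIV_const)
  moreover have "smooth_map \<phi>"
    using affine by (intro smooth_map_affine[of \<phi> "(*v) A" b]) auto
  ultimately show "infinity_harmonic \<phi>"
    unfolding infinity_harmonic_def frechet_derivative_at[OF d, symmetric] by simp
qed

end
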